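(* Let $p\in[0,1]$. For every correlation clustering instance $G=(V,E)$ with optimal clustering $OPT$ of cost $C_{OPT}$, the randomized algorithm \textsc{RandomQueryPivot}$(p)$ (described in the context), run with the oracle corresponding to $OPT$, outputs a clustering whose expected number of mistakes is at most $\max\left(2,\frac{3}{1+2p}\right)C_{OPT}$, and the expected number of queries it issues is at most $\max(4p,1)\,C_{OPT}$.
   Context: Correlation clustering: the input is a complete graph $G=(V,E)$ in which every edge is labeled $+$ or $-$. A clustering is a partition of $V$; it makes a mistake on a $+$ edge whose endpoints are in different clusters and on a $-$ edge whose endpoints are in the same cluster. An optimal clustering $OPT$ minimizes the number of mistakes, which is denoted $C_{OPT}$. The oracle answers a query on $\{u,v\}$ by saying whether $OPT$ makes a mistake on $\{u,v\}$ (equivalently whether $OPT$ puts $u,v$ together). A $(+,+,-)$ triangle is a set of three vertices two of whose edges are $+$ and one is $-$. \textsc{RandomQueryPivot}$(p)$ on remaining vertex set $V$: if $V=\emptyset$ return the empty clustering. Otherwise choose a pivot $u$ uniformly at random from $V$. All edges $\{u,x\}$ start unmarked. For each $(+,+,-)$ triangle $\{u,v,w\}$ with $v,w\in V$, independently with probability $p$ do the following (and with probability $1-p$ do nothing for this triangle): (1) if $\{u,v\}$ and $\{u,w\}$ are both $+$ edges, query both and mark each of them as a mistake iff $OPT$ makes a mistake on it; (2) if one of $\{u,v\},\{u,w\}$ is $+$ and the other is $-$, query the $+$ edge and mark it as a mistake if $OPT$ makes a mistake on it; if $OPT$ does not make a mistake on the $+$ edge, query the $-$ edge and mark it as a mistake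 iff $OPT$ makes a mistake on it. Afterwards let $C$ consist of $u$ and every $x\in V\setminus\{u\}$ such that either $\{u,x\}$ is $+$ and unmarked, or $\{u,x\}$ is $-$ and marked. Return $\{C\}$ together with \textsc{RandomQueryPivot}$(p)$ applied to $V\setminus C$. *)

theory Defs
  imports "HOL-Probability.Probability" "HOL-Library.Disjoint_Sets"
begin

text \<open>
  An instance of correlation clustering is a finite vertex set \<open>V\<close> together with a labelling of the
  edges of the complete graph on \<open>V\<close>, that is, of the two-element subsets of \<open>V\<close>. Labellings are
  total functions on sets; only their values on those edges are ever used.
\<close>

datatype sign = Plus | Minus

definition edges :: "'a set \<Rightarrow> 'a set set" where
  "edges V = {e. e \<subseteq> V \<and> card e = 2}"

text \<open>Clusterings are partitions \<^term>\<open>partition_on V P\<close> as in the library.\<close>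

definition together :: "'a set set \<Rightarrow> 'a set \<Rightarrow> bool" where
  "together P e \<longleftrightarrow> (\<exists>C\<in>P. e \<subseteq> C)"

definition mistakes :: "'a set \<Rightarrow> ('a set \<Rightarrow> sign) \<Rightarrow> 'a set set \<Rightarrow> 'a set set" where
  "mistakes V lab P =
     {e \<in> edges V. (lab e = Plus \<and> \<not> together P e) \<or> (lab e = Minus \<and> together P e)}"

definition cost :: "'a set \<Rightarrow> ('a set \<Rightarrow> sign) \<Rightarrow> 'a set set \<Rightarrow> nat" where
  "cost V lab P = card (mistakes V lab P)"

definition optimal_clustering :: "'a set \<Rightarrow> ('a set \<Rightarrow> sign) \<Rightarrow> 'a set set \<Rightarrow> bool" where
  "optimal_clustering V lab P \<longleftrightarrow>
     partition_on V P \<and> (\<forall>P'. partition_on V P' \<longrightarrow> cost V lab P \<le> cost V lab P')"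

definition ppm_triangles :: "'a set \<Rightarrow> ('a set \<Rightarrow> sign) \<Rightarrow> 'a set set" where
  "ppm_triangles V lab =
     {t. t \<subseteq> V \<and> card t = 3 \<and> card {e \<in> edges t. lab e = Plus} = 2
           \<and> card {e \<in> edges t. lab e = Minus} = 1}"

text \<open>
  An oracle is a predicate on edges; a positive answer means that the reference clustering makes a
  mistake on the edge. The following is the set of edges queried for a selected triangle \<open>t\<close>
  containing the pivot \<open>u\<close>: if both edges of \<open>t\<close> at \<open>u\<close> are positive, both are queried; otherwise
  the positive one is queried, and the negative one is queried only if the answer was negative.
\<close>

definition triangle_queries ::
    "('a set \<Rightarrow> sign) \<Rightarrow> ('a set \<Rightarrow> bool) \<Rightarrow> 'a \<Rightarrow> 'a set \<Rightarrow> 'a set set" where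
  "triangle_queries lab orc u t =
     (let A = {e \<in> edges t. u \<in> e \<and> lab e = Plus};
          B = {e \<in> edges t. u \<in> e \<and> lab e = Minus}
      in if B = {} then A
         else if \<exists>e\<in>A. orc e then A
         else A \<union> B)"

definition pivot_cluster :: "'a set \<Rightarrow> ('a set \<Rightarrow> sign) \<Rightarrow> 'a \<Rightarrow> 'a set set \<Rightarrow> 'a set" where
  "pivot_cluster V lab u M =
     insert u {x \<in> V - {u}. (lab {u, x} = Plus \<and> {u, x} \<notin> M) \<or> (lab {u, x} = Minus \<and> {u, x} \<in> M)}"

text \<open>
  The algorithm returns the clustering together with the set of all queried edges. An edge that is
  queried on behalf of several triangles therefore counts as one query, its answer being known after
  the first time. An edge is marked iff it was queried and the oracle reported a mistake, so
  the order in which triangles are processed is irrelevant. The value for infinite \<open>V\<close> is a dummy.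
\<close>

function random_query_pivot ::
    "real \<Rightarrow> ('a set \<Rightarrow> sign) \<Rightarrow> ('a set \<Rightarrow> bool) \<Rightarrow> 'a set \<Rightarrow> ('a set set \<times> 'a set set) pmf" where
  "random_query_pivot p lab orc V =
     (if infinite V \<or> V = {} then return_pmf ({}, {})
      else do {
        u \<leftarrow> pmf_of_set V;
        coin \<leftarrow> Pi_pmf {t \<in> ppm_triangles V lab. u \<in> t} False (\<lambda>_. bernoulli_pmf p);
        let Q = (\<Union>t \<in> {t \<in> ppm_triangles V lab. u \<in> t \<and> coin t}. triangle_queries lab orc u t);
        let M = {e \<in> Q. orc e};
        let C = pivot_cluster V lab u M;
        (P, Q') \<leftarrow> random_query_pivot p lab orc (V - C);
        return_pmf (insert C P, Q \<union> Q')
      })"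
  by pat_completeness auto
termination
proof (relation "Wellfounded.measure (\<lambda>(p, lab, orc, V). card V)", goal_cases)
  case 1
  show ?case by simp
next
  case (2 p lab orc V u coin Q M C)
  then have "finite V" "u \<in> V" by auto
  moreover have "u \<in> C" using 2 by (simp add: pivot_cluster_def)
  ultimately show ?case by (auto intro!: psubset_card_mono)
qed

declare random_query_pivot.simps [simp del]

end

theory Submission
  imports Defs
begin

text \<open>
  Only the fact that \<open>OPT\<close> is a partition matters, not its optimality. By induction on the
  vertex set it suffices to compare, for one round on \<open>V\<close> and on average over the pivot, the new
  mistakes (resp. queries) of the algorithm with the reference mistakes that lie on removed edges.

  Edges at the pivot become mistakes only if they are marked reference mistakes. An edge \<open>vw\<close> away
  from the pivot \<open>u\<close> becomes a new mistake that the reference does not make only if \<open>uv\<close> or \<open>uw\<close>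
  is an unmarked reference mistake. If both are reference mistakes, the new mistake is charged to
  their removal when \<open>v\<close> or \<open>w\<close> is the pivot. If only \<open>uv\<close> is, then \<open>uvw\<close> is a \<open>(+,+,-)\<close> triangle
  whose only reference mistake is \<open>uv\<close>, and \<open>uv\<close> is certainly removed when \<open>w\<close> is the pivot. If
  \<open>j\<close> such triangles rest on \<open>uv\<close>, then \<open>uv\<close> stays unmarked with probability at most \<open>(1 - p)^j\<close>,
  which leaves a one-variable inequality for each reference mistake.

  For the queries, a query of a reference mistake is paid for by the removal of that edge. All other
  queries come from triangles with exactly one reference mistake; such a triangle causes at most
  four of them over its three pivots, and its mistake is removed when the opposite vertex is the pivot.
\<close>

section \<open>Edges and triangles with two positive edges and one negative edge\<close>

lemma finite_edges: "finite V \<Longrightarrow> finite (edges V)"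
  by (rule finite_subset[of _ "Pow V"]) (auto simp: edges_def)

lemma doubleton_in_edges: "{x, y} \<in> edges V \<longleftrightarrow> x \<in> V \<and> y \<in> V \<and> x \<noteq> y"
  by (cases "x = y") (auto simp: edges_def)

lemma edges_cases:
  assumes "e \<in> edges V"
  obtains x y where "e = {x, y}" "x \<in> V" "y \<in> V" "x \<noteq> y"
  using assms by (auto simp: edges_def card_2_iff)

lemma edges_doubleton_at:
  assumes "e \<in> edges V" "u \<in> e"
  obtains x where "e = {u, x}" "u \<in> V" "x \<in> V" "x \<noteq> u"
  using assms by (auto simp: edges_def card_2_iff)

lemma edges_triple:
  assumes "u \<noteq> v" "u \<noteq> w" "v \<noteq> w"
  shows "edges {u, v, w} = {{u, v}, {u, w}, {v, w}}"
proof
  show "edges {u, v, w} \<subseteq> {{u, v}, {u, w}, {v, w}}"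
    by (auto elim!: edges_cases)
  show "{{u, v}, {u, w}, {v, w}} \<subseteq> edges {u, v, w}"
    using assms by (auto simp: doubleton_in_edges)
qed

lemma Collect_mem_triple:
  "{x \<in> {a, b, c}. P x} = (if P a then {a} else {}) \<union> (if P b then {b} else {}) \<union> (if P c then {c} else {})"
  by auto

lemma not_Plus_iff: "s \<noteq> Plus \<longleftrightarrow> s = Minus"
  by (cases s) auto

lemma ppm_triple_iff:
  assumes "u \<noteq> v" "u \<noteq> w" "v \<noteq> w"
  shows "{u, v, w} \<in> ppm_triangles V lab \<longleftrightarrow> {u, v, w} \<subseteq> V \<and>
    ((lab {u, v} = Minus \<and> lab {u, w} = Plus \<and> lab {v, w} = Plus) \<or>
     (lab {u, v} = Plus \<and> lab {u, w} = Minus \<and> lab {v, w} = Plus) \<or>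
     (lab {u, v} = Plus \<and> lab {u, w} = Plus \<and> lab {v, w} = Minus))"
proof -
  have ne: "{u, v} \<noteq> {u, w}" "{u, v} \<noteq> {v, w}" "{u, w} \<noteq> {v, w}"
    using assms by (auto simp: doubleton_eq_iff)
  show ?thesis
    using assms ne unfolding ppm_triangles_def mem_Collect_eq edges_triple[OF assms] Collect_mem_triple
    by (cases "lab {u, v}"; cases "lab {u, w}"; cases "lab {v, w}") simp_all
qed

lemma triangle_queries_triple:
  assumes "u \<noteq> v" "u \<noteq> w" "v \<noteq> w" "{u, v, w} \<in> ppm_triangles V lab"
  shows "triangle_queries lab orc u {u, v, w} =
    (if lab {u, v} = Plus \<and> lab {u, w} = Plus then {{u, v}, {u, w}}
     else if lab {u, v} = Plus then (if orc {u, v} then {{u, v}} else {{u, v}, {u, w}})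
     else (if orc {u, w} then {{u, w}} else {{u, v}, {u, w}}))"
proof -
  have "u \<notin> {v, w}" using assms by simp
  then show ?thesis
    using assms(4)[unfolded ppm_triple_iff[OF assms(1-3)]]
    unfolding triangle_queries_def edges_triple[OF assms(1-3)] Let_def Collect_mem_triple
    by (elim conjE disjE) (simp_all add: insert_commute)
qed

text \<open>Positive edges at the pivot are always queried. If \<open>{u, v}\<close> is negative,
  then \<open>{u, w}\<close> is positive and is asked first, so its answer decides whether
  \<open>{u, v}\<close> is queried as well.\<close>

lemma queried_in_triple_iff:
  assumes "u \<noteq> v" "u \<noteq> w" "v \<noteq> w" "{u, v, w} \<in> ppm_triangles V lab"
  shows "{u, v} \<in> triangle_queries lab orc u {u, v, w} \<longleftrightarrow> lab {u, v} = Plus \<or> \<not> orc {u, w}"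
  using assms(4)[unfolded ppm_triple_iff[OF assms(1-3)]] assms(1-3)
  by (auto simp: triangle_queries_triple[OF assms] doubleton_eq_iff)

lemma ppm_triangle_at:
  assumes "t \<in> ppm_triangles V lab" "u \<in> t" "x \<in> t" "x \<noteq> u"
  obtains w where "t = {u, x, w}" "w \<in> V" "w \<noteq> u" "w \<noteq> x" "u \<in> V" "x \<in> V"
proof -
  have t: "t \<subseteq> V" "card t = 3" using assms(1) by (auto simp: ppm_triangles_def)
  then obtain a b c where "t = {a, b, c}" "a \<noteq> b" "b \<noteq> c" "a \<noteq> c"
    by (auto simp: card_3_iff)
  with assms t(1) that show thesis
    by (metis insertE insert_commute insert_subset singletonD)
qed

lemma triangle_queries_at_pivot:
  assumes "e \<in> triangle_queries lab orc u t"
  shows "u \<in> e \<and> e \<subseteq> t \<and> e \<in> edges t"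
  using assms by (auto simp: triangle_queries_def edges_def Let_def split: if_splits)

text \<open>Ordered pairs avoid the case distinctions on which vertex of a triangle plays which role;
  they count every edge that misses \<open>u\<close> twice.\<close>

definition pairs_off :: "'a set \<Rightarrow> 'a \<Rightarrow> ('a \<times> 'a) set" where
  "pairs_off V u = {(v, w). v \<in> V - {u} \<and> w \<in> V - {u} \<and> v \<noteq> w}"

lemma finite_pairs_off: "finite V \<Longrightarrow> finite (pairs_off V u)"
  by (rule finite_subset[of _ "V \<times> V"]) (auto simp: pairs_off_def)

lemma card_edges_split:
  assumes "finite V" "X \<subseteq> edges V" "u \<in> V"
  shows "real (card X) = (\<Sum>v\<in>V - {u}. of_bool ({u, v} \<in> X))
           + (\<Sum>(v, w)\<in>pairs_off V u. of_bool ({v, w} \<in> X)) / 2"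
proof -
  have finX: "finite X" using assms finite_edges finite_subset by blast
  define X1 where "X1 = {e \<in> X. u \<in> e}"
  define X2 where "X2 = {e \<in> X. u \<notin> e}"
  have "X = X1 \<union> X2" "X1 \<inter> X2 = {}" "finite X1" "finite X2"
    using finX by (auto simp: X1_def X2_def)
  then have cX: "card X = card X1 + card X2"
    by (simp add: card_Un_disjoint)
  have "bij_betw (\<lambda>v. {u, v}) {v \<in> V - {u}. {u, v} \<in> X} X1"
  proof (rule bij_betwI')
    fix e assume e: "e \<in> X1"
    then have "e \<in> edges V" "u \<in> e" using assms(2) by (auto simp: X1_def)
    then obtain v where "e = {u, v}" "v \<in> V" "v \<noteq> u"
      by (rule edges_doubleton_at)
    with e show "\<exists>v\<in>{v \<in> V - {u}. {u, v} \<in> X}. e = {u, v}"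
      by (auto simp: X1_def)
  qed (auto simp: X1_def doubleton_eq_iff)
  then have c1: "card X1 = card {v \<in> V - {u}. {u, v} \<in> X}"
    by (simp add: bij_betw_same_card)
  have s1: "(\<Sum>v\<in>V - {u}. of_bool ({u, v} \<in> X)) = real (card X1)"
    using assms(1) by (auto simp: c1 intro!: arg_cong[of _ _ card])
  define Y where "Y = {(v, w) \<in> pairs_off V u. {v, w} \<in> X}"
  have finY: "finite Y" unfolding Y_def
    by (rule finite_subset[OF _ finite_pairs_off[OF assms(1)]]) auto
  have "(\<lambda>(v, w). {v, w}) ` Y \<subseteq> X2"
    by (auto simp: Y_def X2_def pairs_off_def)
  moreover have "finite X2" using finX by (simp add: X2_def)
  \<comment> \<open>Ordered pairs are grouped by their underlying edge; every fibre consists of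
    \<open>(x, y)\<close> and \<open>(y, x)\<close>.\<close>
  ultimately have "(\<Sum>y\<in>Y. 1) = (\<Sum>e\<in>X2. \<Sum>y\<in>{y \<in> Y. (\<lambda>(v, w). {v, w}) y = e}. 1::nat)"
    using sum.group[of Y X2 "\<lambda>(v, w). {v, w}" "\<lambda>_. 1::nat"] finY by presburger
  also have "\<dots> = (\<Sum>e\<in>X2. 2)"
  proof (rule sum.cong[OF refl])
    fix e assume e: "e \<in> X2"
    then have "e \<in> edges V" using assms(2) by (auto simp: X2_def)
    then obtain x y where xy: "e = {x, y}" "x \<in> V" "y \<in> V" "x \<noteq> y"
      by (rule edges_cases)
    have mem: "(v, w) \<in> Y" if "{v, w} = e" "v \<in> V" "w \<in> V" "v \<noteq> w" for v w
      using e that by (simp add: Y_def X2_def pairs_off_def) blast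
    have mem1: "(x, y) \<in> Y" by (rule mem) (use xy in simp_all)
    have mem2: "(y, x) \<in> Y" by (rule mem) (use xy in \<open>simp_all add: doubleton_eq_iff\<close>)
    have "{z \<in> Y. (\<lambda>(v, w). {v, w}) z = e} = {(x, y), (y, x)}"
    proof (intro equalityI subsetI)
      fix z assume z: "z \<in> {z \<in> Y. (\<lambda>(v, w). {v, w}) z = e}"
      obtain v w where vw: "z = (v, w)" by (cases z)
      with z xy(1) have "{v, w} = {x, y}" by simp
      then show "z \<in> {(x, y), (y, x)}" by (simp add: vw doubleton_eq_iff)
    next
      fix z assume "z \<in> {(x, y), (y, x)}"
      then consider "z = (x, y)" | "z = (y, x)" by blast
      then show "z \<in> {z \<in> Y. (\<lambda>(v, w). {v, w}) z = e}"
        by cases (simp_all add: mem1 mem2 xy(1) doubleton_eq_iff)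
    qed
    then have "(\<Sum>y\<in>{y \<in> Y. (\<lambda>(v, w). {v, w}) y = e}. 1::nat) = card {(x, y), (y, x)}"
      by (simp only: card_eq_sum)
    with xy(4) show "(\<Sum>y\<in>{y \<in> Y. (\<lambda>(v, w). {v, w}) y = e}. 1::nat) = 2"
      by simp
  qed
  finally have c2: "card Y = 2 * card X2" by simp
  have "(\<Sum>(v, w)\<in>pairs_off V u. of_bool ({v, w} \<in> X)) = real (card Y)"
    using finite_pairs_off[OF assms(1), of u]
    by (auto simp: Y_def split_def intro!: arg_cong[of _ _ card])
  with s1 c2 cX show ?thesis by simp
qed

section \<open>Independent coins and expectations over finite supports\<close>

lemma prob_Pi_bernoulli_none:
  assumes "finite A" "T \<subseteq> A" "0 \<le> p" "p \<le> 1"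
  shows "measure_pmf.prob (Pi_pmf A False (\<lambda>_. bernoulli_pmf p)) {f. \<forall>t\<in>T. \<not> f t}
           = (1 - p) ^ card T"
proof -
  have eq: "{f. \<forall>t\<in>T. \<not> f t} = Pi A (\<lambda>x. if x \<in> T then {False} else UNIV)"
    using assms(2) by (auto simp: Pi_def)
  have "measure_pmf.prob (bernoulli_pmf p) (if x \<in> T then {False} else UNIV) =
      (if x \<in> T then 1 - p else 1)" for x
    using assms by (simp add: measure_pmf_single)
  then have "measure_pmf.prob (Pi_pmf A False (\<lambda>_. bernoulli_pmf p)) {f. \<forall>t\<in>T. \<not> f t}
      = (\<Prod>x\<in>A. if x \<in> T then 1 - p else 1)"
    unfolding eq by (subst measure_Pi_pmf_Pi[OF assms(1)]) simp
  also have "\<dots> = (1 - p) ^ card T"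
    using assms(1,2) by (simp add: prod.If_cases Int_absorb1)
  finally show ?thesis .
qed

lemma finite_set_Pi_bernoulli:
  "finite A \<Longrightarrow> finite (set_pmf (Pi_pmf A False (\<lambda>_. bernoulli_pmf p)))"
  by (simp add: set_Pi_pmf finite_PiE_dflt)

lemma expectation_mono_finite:
  fixes f g :: "'a \<Rightarrow> real"
  assumes "finite (set_pmf M)" "\<And>x. x \<in> set_pmf M \<Longrightarrow> f x \<le> g x"
  shows "measure_pmf.expectation M f \<le> measure_pmf.expectation M g"
  using assms by (intro integral_mono_AE) (auto simp: AE_measure_pmf_iff integrable_measure_pmf_finite)

lemma expectation_bind_finite:
  fixes h :: "'b \<Rightarrow> real"
  assumes "finite (set_pmf M)" "\<And>x. x \<in> set_pmf M \<Longrightarrow> finite (set_pmf (K x))"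
  shows "measure_pmf.expectation (bind_pmf M K) h
           = measure_pmf.expectation M (\<lambda>x. measure_pmf.expectation (K x) h)"
  using assms
  by (subst pmf_expectation_bind[of "set_pmf M"]) (auto simp: integral_measure_pmf_real[of "set_pmf M"] mult.commute integral_measure_pmf)

lemma sum_of_bool_filter:
  "finite A \<Longrightarrow> (\<Sum>x\<in>A. of_bool (P x)) = real (card {x \<in> A. P x})"
  by (auto intro!: arg_cong[of _ _ card])

lemma expectation_of_bool:
  "measure_pmf.expectation M (\<lambda>x. of_bool (Q x)) = measure_pmf.prob M {x. Q x}"
proof -
  have "(\<lambda>x. of_bool (Q x) :: real) = indicator {x. Q x}"
    by (auto simp: indicator_def)
  then show ?thesis by simp
qed

lemma pairs_off_Sigma: "pairs_off V u = (SIGMA v:V - {u}. V - {u, v})"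
  by (auto simp: pairs_off_def)

lemma expectation_card_edges:
  assumes "finite V" "u \<in> V" "finite (set_pmf M)" "\<And>f. X f \<subseteq> edges V"
  shows "measure_pmf.expectation M (\<lambda>f. real (card (X f)))
    = (\<Sum>v\<in>V - {u}. measure_pmf.prob M {f. {u, v} \<in> X f})
      + (\<Sum>(v, w)\<in>pairs_off V u. measure_pmf.prob M {f. {v, w} \<in> X f}) / 2"
  unfolding card_edges_split[OF assms(1,4,2)]
  using assms(3)
  by (simp add: integrable_measure_pmf_finite expectation_of_bool[symmetric] split_def)

section \<open>Sums over ordered triples of distinct vertices, with the pivot in first place\<close>

definition triples :: "'a set \<Rightarrow> ('a \<times> 'a \<times> 'a) set" where
  "triples V = (SIGMA u:V. pairs_off V u)"

lemma in_triples: "(u, v, w) \<in> triples V \<longleftrightarrow> {u, v, w} \<subseteq> V \<and> u \<noteq> v \<and> u \<noteq> w \<and> v \<noteq> w"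
  by (auto simp: triples_def pairs_off_def)

text \<open>Changing which vertex of a triple acts as the pivot is how a charge moves from one pivot
  to another.\<close>

lemma sum_triples_rotate:
  "(\<Sum>(u, v, w)\<in>triples V. g u v w) = (\<Sum>(u, v, w)\<in>triples V. g v w u)"
  by (rule sum.reindex_bij_witness[where i = "\<lambda>(u, v, w). (v, w, u)" and j = "\<lambda>(u, v, w). (w, u, v)"])
     (auto simp: in_triples)

lemma sum_triples_swap:
  "(\<Sum>(u, v, w)\<in>triples V. g u v w) = (\<Sum>(u, v, w)\<in>triples V. g u w v)"
  by (rule sum.reindex_bij_witness[where i = "\<lambda>(u, v, w). (u, w, v)" and j = "\<lambda>(u, v, w). (u, w, v)"])
     (auto simp: in_triples)

lemma sum_triples:
  "finite V \<Longrightarrow> (\<Sum>(u, v, w)\<in>triples V. g u v w) = (\<Sum>u\<in>V. \<Sum>(v, w)\<in>pairs_off V u. g u v w)"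
  unfolding triples_def by (subst sum.Sigma) (auto simp: finite_pairs_off split_def)

lemma sum_triples_nested:
  assumes "finite V"
  shows "(\<Sum>(u, v, w)\<in>triples V. g u v w) = (\<Sum>u\<in>V. \<Sum>v\<in>V - {u}. \<Sum>w\<in>V - {u, v}. g u v w)"
  unfolding sum_triples[OF assms] pairs_off_Sigma
  using assms by (subst sum.Sigma) (auto simp: split_def)

text \<open>With \<open>j\<close> triangles resting on one reference mistake \<open>e\<close>, and \<open>q\<close> the probability that \<open>e\<close>
  stays unmarked when one of its ends is the pivot, this is the inequality to which the
  approximation bound reduces. With \<open>q = 1 - p\<close> it can fail for large \<open>j\<close>, so it matters
  that all \<open>j\<close> coins have to fail simultaneously.\<close>

lemma charge_inequality:
  fixes p q a :: real
  assumes p: "0 \<le> p" "p \<le> 1" and q: "0 \<le> q" "q \<le> (1 - p) ^ j"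
    and a: "3 / (1 + 2 * p) \<le> a" "1 \<le> a"
  shows "2 * (1 - q + real j * q) \<le> 2 * a + (a - 1) * real j"
proof (cases j)
  case 0
  with q a show ?thesis by simp
next
  case (Suc n)
  \<comment> \<open>For \<open>j = n + 1\<close> the goal simplifies to
    \<open>2 * n * q <= (a - 1) * (n + 3)\<close>, because
    \<open>2 * a = 2 + 2 * (a - 1)\<close>.\<close>
  have pos: "0 < 1 + 2 * p" using p by simp
  have "(1 - p) ^ n * (1 + real n * p) \<le> (1 - p) ^ n * (1 + p) ^ n"
    using Bernoulli_inequality[of p n] p by (intro mult_left_mono) auto
  also have "\<dots> = (1 - p\<^sup>2) ^ n"
    by (simp add: power_mult_distrib[symmetric] power2_eq_square algebra_simps)
  also have "\<dots> \<le> 1"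
    using p by (intro power_le_one) (auto simp: power_le_one)
  finally have b: "(1 - p) ^ n * (1 + real n * p) \<le> 1" .
  \<comment> \<open>The right factor exceeds the left one by
    \<open>3 + n * p + n^2 * p\<close>.\<close>
  have "(1 - p) ^ n * (real n * (1 + 2 * p)) \<le> (1 - p) ^ n * ((real n + 3) * (1 + real n * p))"
    using p by (intro mult_left_mono) (auto simp: algebra_simps)
  also have "\<dots> \<le> (real n + 3) * 1"
    using b mult_left_mono[of "(1 - p) ^ n * (1 + real n * p)" 1 "real n + 3"]
    by (simp add: mult_ac)
  finally have "(1 - p) ^ n * (real n * (1 + 2 * p)) \<le> real n + 3" by simp
  then have "2 * (1 - p) * ((1 - p) ^ n * (real n * (1 + 2 * p))) \<le> 2 * (1 - p) * (real n + 3)"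
    using p by (intro mult_left_mono) auto
  \<comment> \<open>This form exposes the 3 that the lower bound on \<open>a\<close> then replaces
    by \<open>a * (1 + 2 * p)\<close>.\<close>
  also have "\<dots> = (3 - (1 + 2 * p)) * (real n + 3)" by (simp add: algebra_simps)
  also have "\<dots> \<le> (a * (1 + 2 * p) - (1 + 2 * p)) * (real n + 3)"
    using a pos by (intro mult_right_mono) (auto simp: field_simps)
  also have "\<dots> = (a - 1) * (real n + 3) * (1 + 2 * p)" by (simp add: algebra_simps)
  finally have "(2 * real n * (1 - p) ^ j) * (1 + 2 * p) \<le> ((a - 1) * (real n + 3)) * (1 + 2 * p)"
    by (simp only: Suc power_Suc mult_ac)
  then have "2 * real n * (1 - p) ^ j \<le> (a - 1) * (real n + 3)"
    using pos mult_le_cancel_right_pos by blast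
  moreover have "2 * real n * q \<le> 2 * real n * (1 - p) ^ j"
    using q by (intro mult_left_mono) auto
  ultimately show ?thesis by (simp add: Suc algebra_simps)
qed

section \<open>Splitting the cost at a new cluster\<close>

lemma edges_Diff: "{e \<in> edges V. e \<inter> C = {}} = edges (V - C)"
  by (auto simp: edges_def)

text \<open>All blocks of \<open>P\<close> lie in \<open>V - C\<close>, so an edge that meets
  \<open>C\<close> can only be joined by \<open>C\<close> itself, and an edge that avoids
  \<open>C\<close> only by a block of \<open>P\<close>.\<close>

lemma mistakes_insert_cluster:
  assumes "partition_on (V - C) P"
  shows "mistakes V lab (insert C P) =
    {e \<in> edges V. e \<inter> C \<noteq> {} \<and> (lab e = Plus \<longleftrightarrow> \<not> e \<subseteq> C)} \<union> mistakes (V - C) lab P"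
proof -
  have P: "C' \<subseteq> V - C" if "C' \<in> P" for C'
    using assms that by (auto simp: partition_on_def)
  have touch: "together (insert C P) e \<longleftrightarrow> e \<subseteq> C" if "e \<inter> C \<noteq> {}" for e
    using that P by (auto simp: together_def)
  have off: "together (insert C P) e \<longleftrightarrow> together P e" if "e \<in> edges V" "e \<inter> C = {}" for e
  proof -
    have "e \<noteq> {}" using that(1) by (auto simp: edges_def)
    then have "\<not> e \<subseteq> C" using that(2) by blast
    then show ?thesis by (auto simp: together_def)
  qed
  have wrong: "(lab e = Plus \<and> \<not> t) \<or> (lab e = Minus \<and> t) \<longleftrightarrow> (lab e = Plus \<longleftrightarrow> \<not> t)" for e t
    by (cases "lab e") auto
  show ?thesis
  proof (intro equalityI subsetI)
    fix e assume "e \<in> mistakes V lab (insert C P)"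
    then show "e \<in> {e \<in> edges V. e \<inter> C \<noteq> {} \<and> (lab e = Plus \<longleftrightarrow> \<not> e \<subseteq> C)} \<union> mistakes (V - C) lab P"
      unfolding mistakes_def wrong edges_Diff[symmetric]
      by (cases "e \<inter> C = {}") (simp_all add: touch off)
  next
    fix e assume "e \<in> {e \<in> edges V. e \<inter> C \<noteq> {} \<and> (lab e = Plus \<longleftrightarrow> \<not> e \<subseteq> C)} \<union> mistakes (V - C) lab P"
    then show "e \<in> mistakes V lab (insert C P)"
      unfolding mistakes_def wrong edges_Diff[symmetric]
      by (cases "e \<inter> C = {}") (simp_all add: touch off)
  qed
qed

subsection \<open>One round of the algorithm\<close>

text \<open>The reference clustering is encoded by block names \<open>cl\<close>, so being together
  is equality of names. The condition \<open>orc_iff\<close> passes to every subset of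
  \<open>V\<close>, as the recursion requires.\<close>

locale pivot_round =
  fixes p :: real and V :: "'a set" and lab :: "'a set \<Rightarrow> sign" and orc :: "'a set \<Rightarrow> bool"
    and cl :: "'a \<Rightarrow> 'b"
  assumes p: "0 \<le> p" "p \<le> 1" and finite_V: "finite V"
    and orc_iff: "\<And>x y. x \<in> V \<Longrightarrow> y \<in> V \<Longrightarrow> x \<noteq> y \<Longrightarrow>
      orc {x, y} \<longleftrightarrow> (lab {x, y} = Plus \<longleftrightarrow> cl x \<noteq> cl y)"
begin

definition coins :: "'a \<Rightarrow> ('a set \<Rightarrow> bool) pmf" where
  "coins u = Pi_pmf {t \<in> ppm_triangles V lab. u \<in> t} False (\<lambda>_. bernoulli_pmf p)"

definition queried :: "'a \<Rightarrow> ('a set \<Rightarrow> bool) \<Rightarrow> 'a set set" where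
  "queried u f = (\<Union>t\<in>{t \<in> ppm_triangles V lab. u \<in> t \<and> f t}. triangle_queries lab orc u t)"

definition cluster :: "'a \<Rightarrow> ('a set \<Rightarrow> bool) \<Rightarrow> 'a set" where
  "cluster u f = pivot_cluster V lab u {e \<in> queried u f. orc e}"

text \<open>Oracle answers are fixed, so what a selected triangle queries does not depend on the
  coins. Whether \<open>{u, x}\<close> gets queried is therefore decided by the independent coins of
  this set alone.\<close>

definition triggers :: "'a \<Rightarrow> 'a \<Rightarrow> 'a set set" where
  "triggers u x = {t \<in> ppm_triangles V lab. u \<in> t \<and> {u, x} \<in> triangle_queries lab orc u t}"

definition unmarked :: "'a \<Rightarrow> 'a \<Rightarrow> ('a set \<Rightarrow> bool) \<Rightarrow> bool" where
  "unmarked u x f \<longleftrightarrow> orc {u, x} \<and> (\<forall>t\<in>triggers u x. \<not> f t)"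

definition quiet :: "'a \<Rightarrow> 'a \<Rightarrow> real" where
  "quiet u x = (1 - p) ^ card (triggers u x)"

definition new_mistakes :: "'a \<Rightarrow> ('a set \<Rightarrow> bool) \<Rightarrow> 'a set set" where
  "new_mistakes u f =
     {e \<in> edges V. e \<inter> cluster u f \<noteq> {} \<and> (lab e = Plus \<longleftrightarrow> \<not> e \<subseteq> cluster u f)}"

text \<open>The share of the reference cost that leaves the graph in this round; both new mistakes
  and queries are charged to it.\<close>

definition removed_mistakes :: "'a \<Rightarrow> ('a set \<Rightarrow> bool) \<Rightarrow> 'a set set" where
  "removed_mistakes u f = {e \<in> edges V. e \<inter> cluster u f \<noteq> {} \<and> orc e}"

definition mis :: "'a \<Rightarrow> 'a \<Rightarrow> 'a \<Rightarrow> real" where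
  "mis u v w = measure_pmf.prob (coins u) {f. {v, w} \<in> new_mistakes u f}"

definition rem :: "'a \<Rightarrow> 'a \<Rightarrow> 'a \<Rightarrow> real" where
  "rem u v w = measure_pmf.prob (coins u) {f. v \<in> cluster u f \<or> w \<in> cluster u f}"

text \<open>The argument order matters: the first two vertices span the only reference mistake of
  the triangle, and the third is the pivot that is certain to remove it.\<close>

definition lone :: "'a \<Rightarrow> 'a \<Rightarrow> 'a \<Rightarrow> bool" where
  "lone u v w \<longleftrightarrow> {u, v, w} \<in> ppm_triangles V lab \<and> orc {u, v} \<and> \<not> orc {u, w} \<and> \<not> orc {v, w}"

lemma finite_ppm: "finite (ppm_triangles V lab)"
  by (rule finite_subset[of _ "Pow V"]) (auto simp: ppm_triangles_def finite_V)

lemma finite_set_coins: "finite (set_pmf (coins u))"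
  unfolding coins_def by (rule finite_set_Pi_bernoulli) (simp add: finite_ppm)

lemma queried_iff: "{u, x} \<in> queried u f \<longleftrightarrow> (\<exists>t\<in>triggers u x. f t)"
  by (auto simp: queried_def triggers_def)

lemma prob_quiet: "measure_pmf.prob (coins u) {f. \<forall>t\<in>triggers u x. \<not> f t} = quiet u x"
  unfolding coins_def quiet_def
  by (rule prob_Pi_bernoulli_none) (use finite_ppm p in \<open>auto simp: triggers_def\<close>)

lemma prob_unmarked: "orc {u, x} \<Longrightarrow> measure_pmf.prob (coins u) {f. unmarked u x f} = quiet u x"
  by (simp add: unmarked_def prob_quiet)

lemma prob_queried: "measure_pmf.prob (coins u) {f. {u, x} \<in> queried u f} = 1 - quiet u x"
proof -
  have "{f. {u, x} \<in> queried u f} = space (coins u) - {f. \<forall>t\<in>triggers u x. \<not> f t}"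
    by (auto simp: queried_iff)
  then show ?thesis
    by (simp add: measure_pmf.prob_compl prob_quiet del: space_measure_pmf)
qed

lemma quiet_bounds: "0 \<le> quiet u x" "quiet u x \<le> 1"
  using p by (auto simp: quiet_def power_le_one)

lemma pivot_in_cluster: "u \<in> cluster u f"
  by (simp add: cluster_def pivot_cluster_def)

lemma cluster_subset: "u \<in> V \<Longrightarrow> cluster u f \<subseteq> V"
  by (auto simp: cluster_def pivot_cluster_def)

text \<open>A marked edge and an edge without a reference mistake both place \<open>x\<close> as the
  reference does. Only an unmarked reference mistake reverses the placement.\<close>

lemma in_cluster_iff:
  assumes "u \<in> V" "x \<in> V" "x \<noteq> u"
  shows "x \<in> cluster u f \<longleftrightarrow> (cl x = cl u \<longleftrightarrow> \<not> unmarked u x f)"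
  using assms orc_iff[of u x] not_Plus_iff[of "lab {u, x}"]
  by (auto simp: cluster_def pivot_cluster_def unmarked_def queried_iff)

lemma in_cluster_if_Plus:
  assumes "u \<in> V" "x \<in> V" "x \<noteq> u" "lab {u, x} = Plus" "\<not> orc {u, x}"
  shows "x \<in> cluster u f"
  using assms orc_iff[of u x] by (auto simp: in_cluster_iff unmarked_def)

lemma new_mistake_iff:
  assumes "v \<in> V" "w \<in> V" "v \<noteq> w"
  shows "{v, w} \<in> new_mistakes u f \<longleftrightarrow>
    (v \<in> cluster u f \<or> w \<in> cluster u f) \<and>
    (lab {v, w} = Plus \<longleftrightarrow> \<not> (v \<in> cluster u f \<and> w \<in> cluster u f))"
  using assms by (auto simp: new_mistakes_def doubleton_in_edges)

lemma mis_le_rem: "{u, v, w} \<subseteq> V \<Longrightarrow> v \<noteq> w \<Longrightarrow> mis u v w \<le> rem u v w"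
  unfolding mis_def rem_def
  by (rule measure_pmf.finite_measure_mono) (auto simp: new_mistake_iff)

text \<open>Every triangle through a positive edge at the pivot queries that edge, so the set is the
  same from either end. For negative edges the answer on another edge interferes.\<close>

lemma triggers_sym_if_Plus:
  assumes "x \<noteq> u" "lab {u, x} = Plus"
  shows "triggers u x = {t \<in> ppm_triangles V lab. u \<in> t \<and> x \<in> t}"
proof (intro equalityI subsetI)
  fix t assume "t \<in> triggers u x"
  then show "t \<in> {t \<in> ppm_triangles V lab. u \<in> t \<and> x \<in> t}"
    using triangle_queries_at_pivot[of "{u, x}"] by (auto simp: triggers_def)
next
  fix t assume t: "t \<in> {t \<in> ppm_triangles V lab. u \<in> t \<and> x \<in> t}"
  then obtain w where w: "t = {u, x, w}" "w \<noteq> u" "w \<noteq> x"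
    using ppm_triangle_at[of t V lab u x] assms by blast
  with t assms show "t \<in> triggers u x"
    by (auto simp: triggers_def queried_in_triple_iff)
qed

lemma quiet_sym:
  assumes "x \<noteq> u" "lab {u, x} = Plus"
  shows "quiet u x = quiet x u"
proof -
  have "triggers u x = triggers x u"
    using triggers_sym_if_Plus[of x u] triggers_sym_if_Plus[of u x] assms
    by (auto simp: insert_commute)
  then show ?thesis by (simp add: quiet_def)
qed

text \<open>The reference separates the ends of a positive mistake, so from either end joining the
  cluster means staying unmarked, and the same coins decide this.\<close>

lemma prob_in_cluster_sym:
  assumes "u \<in> V" "x \<in> V" "x \<noteq> u" "lab {u, x} = Plus" "orc {u, x}"
  shows "measure_pmf.prob (coins u) {f. x \<in> cluster u f}
       = measure_pmf.prob (coins x) {f. u \<in> cluster x f}"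
proof -
  have sym: "{x, u} = {u, x}" by auto
  have "cl x \<noteq> cl u" using assms orc_iff[of u x] by auto
  then have "x \<in> cluster u f \<longleftrightarrow> unmarked u x f" "u \<in> cluster x f \<longleftrightarrow> unmarked x u f" for f
    using assms by (auto simp: in_cluster_iff)
  then show ?thesis using assms prob_unmarked[of u x] prob_unmarked[of x u] quiet_sym[of x u]
    by (simp add: sym)
qed

lemma rem_sym: "rem u v w = rem u w v"
  by (simp add: rem_def disj_commute)

lemma rem_nonneg: "0 \<le> rem u v w"
  by (simp add: rem_def)

lemma prob_in_cluster_le_rem: "measure_pmf.prob (coins u) {f. v \<in> cluster u f} \<le> rem u v w"
  unfolding rem_def by (rule measure_pmf.finite_measure_mono) auto

text \<open>For negative \<open>vw\<close> the event on the left puts into the cluster of \<open>u\<close> an endpoint \<open>x\<close> whose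
  positive edge to \<open>u\<close> is a reference mistake. The same triangles decide on marking \<open>ux\<close> when \<open>x\<close> is
  the pivot, so the two memberships have equal probability. For positive \<open>vw\<close> the right-hand side
  is at least 1.\<close>

lemma mis_two_mistakes:
  assumes V: "{u, v, w} \<subseteq> V" and ne: "u \<noteq> v" "u \<noteq> w" "v \<noteq> w"
    and orc: "orc {u, v}" "orc {u, w}" "\<not> orc {v, w}"
  shows "mis u v w \<le> rem w u v + rem v u w"
proof (cases "lab {v, w} = Plus")
  case True
  have "{f. u \<in> cluster w f \<or> v \<in> cluster w f} = UNIV"
    using in_cluster_if_Plus[of w v] True V ne orc by (auto simp: insert_commute)
  then have "rem w u v = 1" unfolding rem_def by simp
  moreover have "mis u v w \<le> 1" by (simp add: mis_def)
  ultimately show ?thesis using rem_nonneg[of v u w] by linarith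
next
  case False
  \<comment> \<open>A negative edge becomes a mistake only if both its ends join the cluster, so
    either end may be used for the bound.\<close>
  have aux: "measure_pmf.prob (coins u) {f. {v, w} \<in> new_mistakes u f}
      \<le> measure_pmf.prob (coins u) {f. x \<in> cluster u f}" if "x \<in> {v, w}" for x
    using that V ne False by (intro measure_pmf.finite_measure_mono) (auto simp: new_mistake_iff)
  \<comment> \<open>The reference separates \<open>v\<close> from \<open>w\<close>, hence
    \<open>u\<close> from at least one of them.\<close>
  have "cl v \<noteq> cl w" using False orc V ne orc_iff[of v w] by auto
  then consider "cl v \<noteq> cl u" | "cl w \<noteq> cl u" by metis
  then show ?thesis
  proof cases
    case 1
    then have "lab {u, v} = Plus" using V ne orc orc_iff[of u v] by auto
    then have "mis u v w \<le> rem v u w"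
      using aux[of v] prob_in_cluster_sym[of u v] prob_in_cluster_le_rem[of v u w] V ne orc
      unfolding mis_def by auto
    then show ?thesis using rem_nonneg[of w u v] by linarith
  next
    case 2
    then have "lab {u, w} = Plus" using V ne orc orc_iff[of u w] by auto
    then have "mis u v w \<le> rem w u v"
      using aux[of w] prob_in_cluster_sym[of u w] prob_in_cluster_le_rem[of w u v] V ne orc
      unfolding mis_def by auto
    then show ?thesis using rem_nonneg[of v u w] by linarith
  qed
qed

text \<open>If \<open>v\<close> were placed as in the reference, then so would be \<open>w\<close>,
  and \<open>vw\<close> would be a mistake of the reference too. So \<open>uv\<close> is an unmarked
  mistake, and comparing block names yields the triangle.\<close>

lemma new_mistake_lone:
  assumes V: "{u, v, w} \<subseteq> V" and ne: "u \<noteq> v" "u \<noteq> w" "v \<noteq> w"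
    and orc: "\<not> orc {u, w}" "\<not> orc {v, w}" and m: "{v, w} \<in> new_mistakes u f"
  shows "unmarked u v f \<and> lone u v w"
proof -
  have c: "v \<in> cluster u f \<longleftrightarrow> (cl v = cl u \<longleftrightarrow> \<not> unmarked u v f)"
    "w \<in> cluster u f \<longleftrightarrow> cl w = cl u"
    using V ne orc by (auto simp: in_cluster_iff unmarked_def)
  have l: "lab {v, w} = Plus \<longleftrightarrow> cl v = cl w" "lab {u, w} = Plus \<longleftrightarrow> cl u = cl w"
    using orc_iff[of v w] orc_iff[of u w] orc V ne by auto
  have m': "(v \<in> cluster u f \<or> w \<in> cluster u f) \<and>
    (lab {v, w} = Plus \<longleftrightarrow> \<not> (v \<in> cluster u f \<and> w \<in> cluster u f))"
    using m V ne by (simp add: new_mistake_iff)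
  have un: "unmarked u v f" using c l m' by metis
  then have o: "orc {u, v}" by (simp add: unmarked_def)
  have l': "lab {u, v} = Plus \<longleftrightarrow> cl u \<noteq> cl v"
    using o orc_iff[of u v] V ne by simp
  \<comment> \<open>Two patterns drop out. If all three blocks differ, \<open>vw\<close> is negative
    and only \<open>v\<close> joins; if \<open>w\<close> alone is apart, neither end joins.\<close>
  have "(cl u = cl v \<and> cl u = cl w) \<or> (cl u \<noteq> cl v \<and> cl u = cl w) \<or> (cl u \<noteq> cl v \<and> cl v = cl w)"
    using c l m' un by metis
  then have "{u, v, w} \<in> ppm_triangles V lab"
    unfolding ppm_triple_iff[OF ne] using V l l' not_Plus_iff[of "lab {u, v}"]
      not_Plus_iff[of "lab {u, w}"] not_Plus_iff[of "lab {v, w}"] by metis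
  with un o orc show ?thesis by (simp add: lone_def)
qed

lemma mis_one_mistake:
  assumes V: "{u, v, w} \<subseteq> V" and ne: "u \<noteq> v" "u \<noteq> w" "v \<noteq> w"
    and orc: "\<not> orc {u, w}" "\<not> orc {v, w}"
  shows "mis u v w \<le> of_bool (lone u v w) * quiet u v"
proof (cases "lone u v w")
  case True
  then have o: "orc {u, v}" by (simp add: lone_def)
  have "mis u v w \<le> measure_pmf.prob (coins u) {f. unmarked u v f}"
    unfolding mis_def using new_mistake_lone[OF assms]
    by (intro measure_pmf.finite_measure_mono) auto
  with True o show ?thesis by (simp add: prob_unmarked)
next
  case False
  then have "{f. {v, w} \<in> new_mistakes u f} = {}"
    using new_mistake_lone[OF assms] by auto
  then show ?thesis by (simp add: mis_def False)
qed

text \<open>The triangle has only one negative edge, so \<open>uv\<close> or \<open>uw\<close> is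
  positive. That edge is no reference mistake and always pulls its end into the cluster of
  \<open>u\<close>.\<close>

lemma rem_lone:
  assumes V: "{u, v, w} \<subseteq> V" and ne: "u \<noteq> v" "u \<noteq> w" "v \<noteq> w" and l: "lone v w u"
  shows "rem u v w = 1"
proof -
  have "{v, w, u} \<in> ppm_triangles V lab" "\<not> orc {u, v}" "\<not> orc {u, w}"
    using l by (auto simp: lone_def insert_commute)
  then have "lab {u, v} = Plus \<or> lab {u, w} = Plus"
    using ne ppm_triple_iff[of v w u V lab] by (auto simp: insert_commute)
  then have "{f. v \<in> cluster u f \<or> w \<in> cluster u f} = UNIV"
    using in_cluster_if_Plus[of u v] in_cluster_if_Plus[of u w] V ne
      \<open>\<not> orc {u, v}\<close> \<open>\<not> orc {u, w}\<close> by auto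
  then show ?thesis by (simp add: rem_def)
qed

text \<open>If the correct edge \<open>uv\<close> is positive, \<open>u\<close> and \<open>v\<close>
  share a block, and of \<open>uw\<close> and \<open>vw\<close>, which have opposite signs, exactly
  one is a mistake. If it is negative, it was queried only because \<open>uw\<close> is correct, so
  \<open>vw\<close> is the single mistake.\<close>

lemma queried_lone:
  assumes V: "{u, v, w} \<subseteq> V" and ne: "u \<noteq> v" "u \<noteq> w" "v \<noteq> w"
    and t: "{u, v, w} \<in> ppm_triangles V lab"
    and q: "{u, v} \<in> triangle_queries lab orc u {u, v, w}" "\<not> orc {u, v}"
  shows "lone v w u \<or> lone u w v"
proof -
  have q': "lab {u, v} = Plus \<or> \<not> orc {u, w}"
    using q queried_in_triple_iff[OF ne t] by simp
  have t': "{v, w, u} \<in> ppm_triangles V lab" "{u, w, v} \<in> ppm_triangles V lab"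
    using t by (simp_all add: insert_commute)
  have s: "{v, u} = {u, v}" "{w, u} = {u, w}" "{w, v} = {v, w}" by auto
  have "orc {u, v} \<longleftrightarrow> (lab {u, v} = Plus \<longleftrightarrow> cl u \<noteq> cl v)"
    "orc {u, w} \<longleftrightarrow> (lab {u, w} = Plus \<longleftrightarrow> cl u \<noteq> cl w)"
    "orc {v, w} \<longleftrightarrow> (lab {v, w} = Plus \<longleftrightarrow> cl v \<noteq> cl w)"
    using V ne by (auto simp: orc_iff)
  then show ?thesis
    using q' q(2) t[unfolded ppm_triple_iff[OF ne]] t' unfolding lone_def s
    by (elim conjE disjE) auto
qed

text \<open>In such a triangle \<open>uw\<close> is correct, so selecting the triangle leads to a
  query of \<open>uv\<close> whatever its sign.\<close>

lemma card_lone_le_triggers: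
  assumes "u \<noteq> v"
  shows "card {w \<in> V - {u, v}. lone u v w} \<le> card (triggers u v)"
proof (rule card_inj_on_le)
  show "inj_on (\<lambda>w. {u, v, w}) {w \<in> V - {u, v}. lone u v w}"
    by (rule inj_onI) auto
  show "(\<lambda>w. {u, v, w}) ` {w \<in> V - {u, v}. lone u v w} \<subseteq> triggers u v"
    using assms by (auto simp: triggers_def lone_def queried_in_triple_iff)
  show "finite (triggers u v)" by (simp add: triggers_def finite_ppm)
qed

lemma card_triggers_le:
  assumes "u \<noteq> v"
  shows "card (triggers u v) \<le> card {w \<in> V - {u, v}. {u, v, w} \<in> ppm_triangles V lab
           \<and> {u, v} \<in> triangle_queries lab orc u {u, v, w}}" (is "_ \<le> card ?W")
proof (rule surj_card_le)
  show "finite ?W" using finite_V by simp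
  show "triggers u v \<subseteq> (\<lambda>w. {u, v, w}) ` ?W"
  proof
    fix t assume t: "t \<in> triggers u v"
    then have "t \<in> ppm_triangles V lab" "u \<in> t" "v \<in> t"
      using triangle_queries_at_pivot[of "{u, v}" lab orc u t] by (simp_all add: triggers_def)
    then obtain w where "t = {u, v, w}" "w \<in> V" "w \<noteq> u" "w \<noteq> v"
      by (rule ppm_triangle_at) (use assms in simp_all)
    with t show "t \<in> (\<lambda>w. {u, v, w}) ` ?W" by (auto simp: triggers_def)
  qed
qed

subsection \<open>Averaging over the pivot\<close>

text \<open>\<open>R\<close> pays for edges that are reference mistakes themselves,
  \<open>R - R1\<close> for edges facing two mistakes at the pivot, and the last sum for edges
  facing exactly one. \<open>R1\<close> is kept in reserve for the lone triangles.\<close>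

lemma sum_mis_le:
  defines "R \<equiv> \<Sum>(u, v, w)\<in>triples V. of_bool (orc {v, w}) * rem u v w"
    and "R1 \<equiv> \<Sum>(u, v, w)\<in>triples V. of_bool (orc {v, w} \<and> \<not> orc {u, v} \<and> \<not> orc {u, w}) * rem u v w"
  shows "(\<Sum>(u, v, w)\<in>triples V. mis u v w)
    \<le> R + (R - R1) + 2 * (\<Sum>(u, v, w)\<in>triples V. of_bool (lone u v w) * quiet u v)"
proof -
  define two where "two u v w = of_bool (orc {v, w} \<and> orc {u, v} \<and> \<not> orc {u, w}) * rem u v w" for u v w
  define L where "L u v w = of_bool (lone u v w) * quiet u v" for u v w
  define R2 where "R2 = (\<Sum>(u, v, w)\<in>triples V. two u v w)"
  \<comment> \<open>The three sums draw on disjoint parts of \<open>R\<close>: neither of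
    \<open>uv\<close> and \<open>uw\<close> is a mistake, only \<open>uv\<close> is, or only
    \<open>uw\<close> is.\<close>
  have "R1 + R2 + (\<Sum>(u, v, w)\<in>triples V. two u w v) \<le> R"
    unfolding R_def R1_def R2_def sum.distrib[symmetric]
    by (rule sum_mono) (auto simp: two_def rem_sym insert_commute rem_nonneg)
  then have R: "R1 + 2 * R2 \<le> R"
    using sum_triples_swap[of two V] by (simp add: R2_def)
  have "mis u v w \<le> of_bool (orc {v, w}) * rem u v w + two w u v + two v u w + L u v w + L u w v"
    if "(u, v, w) \<in> triples V" for u v w
  proof -
    have t: "{u, v, w} \<subseteq> V" "u \<noteq> v" "u \<noteq> w" "v \<noteq> w" using that by (auto simp: in_triples)
    have nn: "0 \<le> two a b c" "0 \<le> L a b c" for a b c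
      by (auto simp: two_def L_def rem_nonneg quiet_bounds)
    have s: "{v, u} = {u, v}" "{w, u} = {u, w}" "{w, v} = {v, w}" by auto
    consider "orc {v, w}" | "\<not> orc {v, w}" "orc {u, v}" "orc {u, w}"
      | "\<not> orc {v, w}" "\<not> orc {u, w}" | "\<not> orc {v, w}" "\<not> orc {u, v}" by blast
    then show ?thesis
    proof cases
      case 1
      then show ?thesis
        using mis_le_rem[of u v w] t nn[of w u v] nn[of v u w] nn[of u v w] nn[of u w v] by simp
    next
      case 2
      have "mis u v w \<le> rem w u v + rem v u w"
        by (rule mis_two_mistakes[OF t 2(2,3,1)])
      moreover have "two w u v = rem w u v" "two v u w = rem v u w"
        using 2 by (simp_all add: two_def s)
      ultimately show ?thesis using 2 nn[of u v w] nn[of u w v] by simp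
    next
      case 3
      then show ?thesis using mis_one_mistake[OF t 3(2,1)] nn[of w u v] nn[of v u w] nn[of u w v]
        by (simp add: L_def[of u v w])
    next
      case 4
      have "mis u w v \<le> L u w v"
        unfolding L_def by (rule mis_one_mistake) (use t 4 in \<open>auto simp: s\<close>)
      moreover have "mis u v w = mis u w v" by (simp add: mis_def s)
      ultimately show ?thesis using 4 nn[of w u v] nn[of v u w] nn[of u v w] by simp
    qed
  qed
  then have "(\<Sum>(u, v, w)\<in>triples V. mis u v w) \<le> (\<Sum>(u, v, w)\<in>triples V.
      of_bool (orc {v, w}) * rem u v w + two w u v + two v u w + L u v w + L u w v)"
    by (intro sum_mono) auto
  also have "\<dots> = R + (\<Sum>(u, v, w)\<in>triples V. two w u v) + (\<Sum>(u, v, w)\<in>triples V. two v u w)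
      + (\<Sum>(u, v, w)\<in>triples V. L u v w) + (\<Sum>(u, v, w)\<in>triples V. L u w v)"
    by (simp add: R_def sum.distrib split_def)
  also have "(\<Sum>(u, v, w)\<in>triples V. two w u v) = R2"
    unfolding R2_def by (rule sum_triples_rotate)
  also have "(\<Sum>(u, v, w)\<in>triples V. two v u w) = R2"
    unfolding R2_def sum_triples_swap[of two V] by (rule sum_triples_rotate[symmetric])
  also have "(\<Sum>(u, v, w)\<in>triples V. L u w v) = (\<Sum>(u, v, w)\<in>triples V. L u v w)"
    by (rule sum_triples_swap[symmetric])
  finally show ?thesis using R by (simp add: L_def)
qed

text \<open>Rotating the triple makes the vertex opposite the mistake the pivot, and then removal
  has probability 1.\<close>

lemma sum_lone_le:
  "(\<Sum>(u, v, w)\<in>triples V. of_bool (lone u v w))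
     \<le> (\<Sum>(u, v, w)\<in>triples V. of_bool (orc {v, w} \<and> \<not> orc {u, v} \<and> \<not> orc {u, w}) * rem u v w)"
proof -
  have "(\<Sum>(u, v, w)\<in>triples V. of_bool (lone u v w) :: real)
      = (\<Sum>(u, v, w)\<in>triples V. of_bool (lone v w u))"
    by (rule sum_triples_rotate)
  also have "\<dots> \<le> (\<Sum>(u, v, w)\<in>triples V. of_bool (orc {v, w} \<and> \<not> orc {u, v} \<and> \<not> orc {u, w}) * rem u v w)"
  proof (intro sum_mono, clarify)
    fix u v w assume "(u, v, w) \<in> triples V"
    then have t: "{u, v, w} \<subseteq> V" "u \<noteq> v" "u \<noteq> w" "v \<noteq> w" by (auto simp: in_triples)
    have s: "{v, u} = {u, v}" "{w, u} = {u, w}" by auto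
    show "of_bool (lone v w u)
        \<le> of_bool (orc {v, w} \<and> \<not> orc {u, v} \<and> \<not> orc {u, w}) * rem u v w"
      using rem_lone[OF t] by (auto simp: lone_def s rem_nonneg)
  qed
  finally show ?thesis .
qed

section \<open>Expected counts in one round\<close>

lemma new_mistakes_subset: "new_mistakes u f \<subseteq> edges V"
  and removed_mistakes_subset: "removed_mistakes u f \<subseteq> edges V"
  by (auto simp: new_mistakes_def removed_mistakes_def)

lemma queried_subset: "queried u f \<subseteq> {e \<in> edges V. u \<in> e}"
proof
  fix e assume "e \<in> queried u f"
  then obtain t where "t \<in> ppm_triangles V lab" "e \<in> triangle_queries lab orc u t"
    by (auto simp: queried_def)
  then show "e \<in> {e \<in> edges V. u \<in> e}"
    using triangle_queries_at_pivot[of e lab orc u t] by (auto simp: edges_def ppm_triangles_def)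
qed

text \<open>The cluster contradicts a label at the pivot exactly on marked edges, and only reference
  mistakes get marked.\<close>

lemma new_mistake_at_pivot:
  assumes "u \<in> V" "v \<in> V" "v \<noteq> u"
  shows "{u, v} \<in> new_mistakes u f \<longleftrightarrow> orc {u, v} \<and> \<not> unmarked u v f"
  using assms orc_iff[of u v] pivot_in_cluster[of u f] new_mistake_iff[of u v u f]
    in_cluster_iff[of u v f] unmarked_def[of u v f] by metis

lemma sum_expectation_new_mistakes:
  "(\<Sum>u\<in>V. measure_pmf.expectation (coins u) (\<lambda>f. real (card (new_mistakes u f))))
    = (\<Sum>u\<in>V. \<Sum>v\<in>V - {u}. of_bool (orc {u, v}) * (1 - quiet u v))
      + (\<Sum>(u, v, w)\<in>triples V. mis u v w) / 2"
proof -
  have "measure_pmf.prob (coins u) {f. {u, v} \<in> new_mistakes u f}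
      = of_bool (orc {u, v}) * (1 - quiet u v)" if "u \<in> V" "v \<in> V - {u}" for u v
  proof (cases "orc {u, v}")
    case True
    then have "{f. {u, v} \<in> new_mistakes u f} = {f. {u, v} \<in> queried u f}"
      using that by (auto simp: new_mistake_at_pivot unmarked_def queried_iff)
    with True show ?thesis by (simp add: prob_queried)
  qed (use that in \<open>simp add: new_mistake_at_pivot\<close>)
  then show ?thesis
    by (simp add: expectation_card_edges[OF finite_V _ finite_set_coins new_mistakes_subset]
        sum_triples[OF finite_V] sum.distrib sum_divide_distrib mis_def)
qed

lemma sum_expectation_removed_mistakes:
  "(\<Sum>u\<in>V. measure_pmf.expectation (coins u) (\<lambda>f. real (card (removed_mistakes u f))))
    = (\<Sum>u\<in>V. \<Sum>v\<in>V - {u}. of_bool (orc {u, v}))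
      + (\<Sum>(u, v, w)\<in>triples V. of_bool (orc {v, w}) * rem u v w) / 2"
proof -
  have 1: "measure_pmf.prob (coins u) {f. {u, v} \<in> removed_mistakes u f} = of_bool (orc {u, v})"
    if "u \<in> V" "v \<in> V - {u}" for u v
  proof -
    have "{u, v} \<in> removed_mistakes u f \<longleftrightarrow> orc {u, v}" for f
      using that pivot_in_cluster[of u f] by (auto simp: removed_mistakes_def doubleton_in_edges)
    then show ?thesis by (cases "orc {u, v}") simp_all
  qed
  have 2: "measure_pmf.prob (coins u) {f. {v, w} \<in> removed_mistakes u f} = of_bool (orc {v, w}) * rem u v w"
    if "(v, w) \<in> pairs_off V u" for u v w
  proof -
    have "{v, w} \<in> removed_mistakes u f \<longleftrightarrow> orc {v, w} \<and> (v \<in> cluster u f \<or> w \<in> cluster u f)" for f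
      using that by (auto simp: pairs_off_def removed_mistakes_def doubleton_in_edges)
    then show ?thesis by (cases "orc {v, w}") (simp_all add: rem_def)
  qed
  have "(\<Sum>(v, w)\<in>pairs_off V u. measure_pmf.prob (coins u) {f. {v, w} \<in> removed_mistakes u f})
     = (\<Sum>(v, w)\<in>pairs_off V u. of_bool (orc {v, w}) * rem u v w)" for u
    by (rule sum.cong) (auto simp: 2)
  with 1 show ?thesis
    by (simp add: expectation_card_edges[OF finite_V _ finite_set_coins removed_mistakes_subset]
        sum_triples[OF finite_V] sum.distrib sum_divide_distrib del: sum_of_bool_eq)
qed

lemma sum_expectation_queried:
  "(\<Sum>u\<in>V. measure_pmf.expectation (coins u) (\<lambda>f. real (card (queried u f))))
    = (\<Sum>u\<in>V. \<Sum>v\<in>V - {u}. 1 - quiet u v)"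
proof (rule sum.cong[OF refl])
  fix u assume u: "u \<in> V"
  have "{f. {v, w} \<in> queried u f} = {}" if "(v, w) \<in> pairs_off V u" for v w
    using that queried_subset[of u] by (auto simp: pairs_off_def)
  then have "(\<Sum>(v, w)\<in>pairs_off V u. measure_pmf.prob (coins u) {f. {v, w} \<in> queried u f}) = 0"
    by (intro sum.neutral) auto
  moreover have "queried u f \<subseteq> edges V" for f using queried_subset[of u f] by auto
  ultimately show "measure_pmf.expectation (coins u) (\<lambda>f. real (card (queried u f)))
      = (\<Sum>v\<in>V - {u}. 1 - quiet u v)"
    by (simp add: expectation_card_edges[OF finite_V u finite_set_coins] prob_queried)
qed

text \<open>Triples are regrouped by the edge carrying the mistake, so that
  \<open>charge_inequality\<close> can be applied edge by edge.\<close>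

lemma sum_lone_weighted:
  fixes g :: "'a \<Rightarrow> 'a \<Rightarrow> real"
  shows "(\<Sum>(u, v, w)\<in>triples V. of_bool (lone u v w) * g u v)
   = (\<Sum>u\<in>V. \<Sum>v\<in>V - {u}. of_bool (orc {u, v}) * (real (card {w \<in> V - {u, v}. lone u v w}) * g u v))"
proof -
  have "(\<Sum>w\<in>V - {u, v}. of_bool (lone u v w) * g u v)
      = of_bool (orc {u, v}) * (real (card {w \<in> V - {u, v}. lone u v w}) * g u v)" for u v
  proof -
    have "(\<Sum>w\<in>V - {u, v}. of_bool (lone u v w) :: real) = real (card {w \<in> V - {u, v}. lone u v w})"
      by (rule sum_of_bool_filter) (simp add: finite_V)
    moreover have "card {w \<in> V - {u, v}. lone u v w} = 0" if "\<not> orc {u, v}"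
    proof -
      have "{w \<in> V - {u, v}. lone u v w} = {}" using that by (auto simp: lone_def)
      then show ?thesis by (simp only: card.empty)
    qed
    ultimately show ?thesis
      by (cases "orc {u, v}") (simp_all only: sum_distrib_right[symmetric] of_bool_eq of_nat_0
          mult_zero_left mult_1_left not_False_eq_True)
  qed
  then show ?thesis by (simp add: sum_triples_nested[OF finite_V])
qed

lemma round_mistakes:
  assumes a: "2 \<le> a" "3 / (1 + 2 * p) \<le> a"
  shows "(\<Sum>u\<in>V. measure_pmf.expectation (coins u) (\<lambda>f. real (card (new_mistakes u f))))
    \<le> a * (\<Sum>u\<in>V. measure_pmf.expectation (coins u) (\<lambda>f. real (card (removed_mistakes u f))))"
proof -
  define R where "R = (\<Sum>(u, v, w)\<in>triples V. of_bool (orc {v, w}) * rem u v w)"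
  define R1 where "R1 = (\<Sum>(u, v, w)\<in>triples V.
      of_bool (orc {v, w} \<and> \<not> orc {u, v} \<and> \<not> orc {u, w}) * rem u v w)"
  define j where "j u v = real (card {w \<in> V - {u, v}. lone u v w})" for u v
  define S where "S g = (\<Sum>u\<in>V. \<Sum>v\<in>V - {u}. of_bool (orc {u, v}) * g u v)" for g :: "'a \<Rightarrow> 'a \<Rightarrow> real"
  have M: "(\<Sum>(u, v, w)\<in>triples V. mis u v w) \<le> R + (R - R1) + 2 * S (\<lambda>u v. j u v * quiet u v)"
    using sum_mis_le sum_lone_weighted[of quiet] by (simp add: R_def R1_def S_def j_def)
  have J: "S j \<le> R1"
    using sum_lone_le sum_lone_weighted[of "\<lambda>_ _. 1"] by (simp add: R1_def S_def j_def)
  have "R1 \<le> R"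
    unfolding R_def R1_def by (intro sum_mono) (auto simp: rem_nonneg)
  then have "(a - 2) * R1 \<le> (a - 2) * R" using a by (intro mult_left_mono) auto
  moreover have "(a - 1) * S j \<le> (a - 1) * R1" using J a by (intro mult_left_mono) auto
  \<comment> \<open>This is where \<open>2 <= a\<close> enters: with \<open>S j <= R1 <= R\<close>
    the left side is at most \<open>2 * R + (a - 2) * R1\<close>.\<close>
  ultimately have RR: "2 * R - R1 + (a - 1) * S j \<le> a * R" by (simp add: algebra_simps)
  have "S (\<lambda>u v. 2 * (1 - quiet u v + j u v * quiet u v)) \<le> S (\<lambda>u v. 2 * a + (a - 1) * j u v)"
    unfolding S_def
  proof (intro sum_mono mult_left_mono)
    fix u v assume "u \<in> V" "v \<in> V - {u}"
    then have "card {w \<in> V - {u, v}. lone u v w} \<le> card (triggers u v)"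
      by (intro card_lone_le_triggers) auto
    \<comment> \<open>Triangles that query \<open>uv\<close> without being lone only add coins,
      which lowers the probability of staying unmarked.\<close>
    then have "quiet u v \<le> (1 - p) ^ card {w \<in> V - {u, v}. lone u v w}"
      unfolding quiet_def using p by (intro power_decreasing) auto
    then show "2 * (1 - quiet u v + j u v * quiet u v) \<le> 2 * a + (a - 1) * j u v"
      unfolding j_def using p a quiet_bounds[of u v] by (intro charge_inequality) auto
  qed simp
  then have E: "2 * S (\<lambda>u v. 1 - quiet u v) + 2 * S (\<lambda>u v. j u v * quiet u v)
      \<le> 2 * a * S (\<lambda>_ _. 1) + (a - 1) * S j"
    by (simp add: S_def sum.distrib sum_distrib_left algebra_simps sum_subtractf del: sum_of_bool_eq sum_mult_of_bool_eq sum_of_bool_mult_eq)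
  have "(\<Sum>u\<in>V. measure_pmf.expectation (coins u) (\<lambda>f. real (card (new_mistakes u f))))
      = S (\<lambda>u v. 1 - quiet u v) + (\<Sum>(u, v, w)\<in>triples V. mis u v w) / 2"
    by (simp only: sum_expectation_new_mistakes S_def)
  moreover have "(\<Sum>u\<in>V. measure_pmf.expectation (coins u) (\<lambda>f. real (card (removed_mistakes u f))))
      = S (\<lambda>_ _. 1) + R / 2"
    by (simp only: sum_expectation_removed_mistakes S_def R_def mult_1_right)
  ultimately show ?thesis using M RR E by (simp add: algebra_simps)
qed

lemma round_queries:
  assumes b: "1 \<le> b" "4 * p \<le> b"
  shows "(\<Sum>u\<in>V. measure_pmf.expectation (coins u) (\<lambda>f. real (card (queried u f))))
    \<le> b * (\<Sum>u\<in>V. measure_pmf.expectation (coins u) (\<lambda>f. real (card (removed_mistakes u f))))"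
proof -
  define R where "R = (\<Sum>(u, v, w)\<in>triples V. of_bool (orc {v, w}) * rem u v w)"
  define J :: real where "J = (\<Sum>(u, v, w)\<in>triples V. of_bool (lone u v w))"
  define Dm :: real where "Dm = (\<Sum>u\<in>V. \<Sum>v\<in>V - {u}. of_bool (orc {u, v}))"
  \<comment> \<open>These are the queries not paid for by the removal of the queried edge
    itself.\<close>
  define fresh where "fresh u v w \<longleftrightarrow> \<not> orc {u, v} \<and> {u, v, w} \<in> ppm_triangles V lab
      \<and> {u, v} \<in> triangle_queries lab orc u {u, v, w}" for u v w
  have "1 - quiet u v \<le> of_bool (orc {u, v}) + p * (\<Sum>w\<in>V - {u, v}. of_bool (fresh u v w))"
    if "u \<in> V" "v \<in> V - {u}" for u v
  proof (cases "orc {u, v}")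
    case True
    then show ?thesis using quiet_bounds[of u v] by (simp add: fresh_def)
  next
    case False
    \<comment> \<open>A union bound over the coins, obtained from Bernoulli's inequality at
      \<open>- p\<close>.\<close>
    have "1 - quiet u v \<le> p * real (card (triggers u v))"
      using Bernoulli_inequality[of "- p" "card (triggers u v)"] p by (simp add: quiet_def mult.commute)
    also have "\<dots> \<le> p * real (card {w \<in> V - {u, v}. fresh u v w})"
      using card_triggers_le[of u v] that False p by (intro mult_left_mono) (auto simp: fresh_def)
    also have "real (card {w \<in> V - {u, v}. fresh u v w}) = (\<Sum>w\<in>V - {u, v}. of_bool (fresh u v w))"
      by (rule sum_of_bool_filter[symmetric]) (simp add: finite_V)
    finally show ?thesis using False by simp
  qed
  then have "(\<Sum>u\<in>V. \<Sum>v\<in>V - {u}. 1 - quiet u v)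
      \<le> (\<Sum>u\<in>V. \<Sum>v\<in>V - {u}. of_bool (orc {u, v}) + p * (\<Sum>w\<in>V - {u, v}. of_bool (fresh u v w)))"
    by (intro sum_mono)
  also have "\<dots> = Dm + p * (\<Sum>(u, v, w)\<in>triples V. of_bool (fresh u v w))"
    by (simp add: Dm_def sum_triples_nested[OF finite_V] sum.distrib sum_distrib_left
        del: sum_of_bool_eq sum_mult_of_bool_eq sum_of_bool_mult_eq)
  also have "(\<Sum>(u, v, w)\<in>triples V. of_bool (fresh u v w))
      \<le> (\<Sum>(u, v, w)\<in>triples V. of_bool (lone v w u) + of_bool (lone u w v) :: real)"
  proof (intro sum_mono, clarify)
    fix u v w assume "(u, v, w) \<in> triples V"
    then have "fresh u v w \<Longrightarrow> lone v w u \<or> lone u w v"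
      using queried_lone[of u v w] by (auto simp: in_triples fresh_def)
    then show "of_bool (fresh u v w) \<le> (of_bool (lone v w u) + of_bool (lone u w v) :: real)"
      by auto
  qed
  also have "\<dots> = 2 * J"
    using sum_triples_rotate[of "\<lambda>u v w. of_bool (lone u v w) :: real" V]
      sum_triples_swap[of "\<lambda>u v w. of_bool (lone u v w) :: real" V]
    by (simp add: J_def split_def sum.distrib del: sum_of_bool_eq)
  finally have Q: "(\<Sum>u\<in>V. \<Sum>v\<in>V - {u}. 1 - quiet u v) \<le> Dm + p * (2 * J)"
    using p by (simp add: mult_left_mono)
  have "J \<le> R"
    unfolding J_def R_def
    by (rule order_trans[OF sum_lone_le]) (intro sum_mono, auto simp: rem_nonneg)
  moreover have "0 \<le> J" unfolding J_def by (intro sum_nonneg) auto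
  \<comment> \<open>The lone triangles cost \<open>2 * p * J\<close> but only \<open>R / 2\<close>
    is available for them, whence the constant \<open>4 * p\<close>.\<close>
  ultimately have "4 * p * J \<le> b * R" using b p by (intro mult_mono) auto
  moreover have "0 \<le> Dm" unfolding Dm_def by (intro sum_nonneg) auto
  then have "1 * Dm \<le> b * Dm" using b by (intro mult_right_mono) auto
  ultimately have "Dm + p * (2 * J) \<le> b * (Dm + R / 2)" by (simp add: algebra_simps)
  with Q show ?thesis
    by (simp only: sum_expectation_queried sum_expectation_removed_mistakes Dm_def R_def)
qed

subsection \<open>Iterating the rounds\<close>

lemma cost_insert_cluster:
  assumes "partition_on (V - cluster u f) P"
  shows "cost V lab (insert (cluster u f) P) = card (new_mistakes u f) + cost (V - cluster u f) lab P"
proof -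
  have "mistakes (V - cluster u f) lab P \<subseteq> {e \<in> edges V. e \<inter> cluster u f = {}}"
    unfolding edges_Diff by (auto simp: mistakes_def)
  moreover from this have "finite (mistakes (V - cluster u f) lab P)"
    by (rule finite_subset) (simp add: finite_edges[OF finite_V])
  moreover have "finite (new_mistakes u f)"
    by (rule finite_subset[OF new_mistakes_subset finite_edges[OF finite_V]])
  ultimately show ?thesis
    unfolding cost_def mistakes_insert_cluster[OF assms] new_mistakes_def[symmetric]
    by (intro card_Un_disjoint) (auto simp: new_mistakes_def)
qed

lemma card_removed_mistakes:
  "card {e \<in> edges V. orc e}
    = card (removed_mistakes u f) + card {e \<in> edges (V - cluster u f). orc e}"
proof -
  have "{e \<in> edges V. orc e} = removed_mistakes u f \<union> {e \<in> edges (V - cluster u f). orc e}"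
    unfolding removed_mistakes_def edges_Diff[symmetric] by auto
  moreover have "removed_mistakes u f \<inter> {e \<in> edges (V - cluster u f). orc e} = {}"
    unfolding removed_mistakes_def edges_Diff[symmetric] by auto
  moreover have "finite (edges V)" "finite (edges (V - cluster u f))"
    using finite_V by (auto intro: finite_edges)
  ultimately show ?thesis
    using finite_subset[OF removed_mistakes_subset[of u f]] by (simp add: card_Un_disjoint)
qed

text \<open>The recursive call is a parameter, so one round can be analysed from bounds on the call
  alone.\<close>

definition round_then :: "('a set \<Rightarrow> ('a set set \<times> 'a set set) pmf) \<Rightarrow> ('a set set \<times> 'a set set) pmf" where
  "round_then rec = bind_pmf (pmf_of_set V) (\<lambda>u. bind_pmf (coins u) (\<lambda>f.
     map_pmf (\<lambda>(P, Q). (insert (cluster u f) P, queried u f \<union> Q)) (rec (V - cluster u f))))"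

lemma random_query_pivot_round:
  "V \<noteq> {} \<Longrightarrow> random_query_pivot p lab orc V = round_then (random_query_pivot p lab orc)"
  using finite_V
  by (subst random_query_pivot.simps)
     (simp add: round_then_def coins_def cluster_def queried_def Let_def map_pmf_def split_def)

lemma set_pmf_round_then:
  assumes "V \<noteq> {}" "x \<in> set_pmf (round_then rec)"
  obtains u f P Q where "u \<in> V" "(P, Q) \<in> set_pmf (rec (V - cluster u f))"
    "x = (insert (cluster u f) P, queried u f \<union> Q)"
  using assms finite_V by (auto simp: round_then_def)

lemma finite_set_round_then:
  assumes "V \<noteq> {}" "\<And>u f. u \<in> V \<Longrightarrow> finite (set_pmf (rec (V - cluster u f)))"
  shows "finite (set_pmf (round_then rec))"
  using assms finite_V finite_set_coins by (auto simp: round_then_def)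

text \<open>A potential argument serving both bounds: the potential is \<open>c\<close> times the
  number of remaining reference mistakes, and \<open>X\<close> is what the round spends. The drop in
  potential must cover the spending only on average over the pivot.\<close>

lemma expectation_round_then_le:
  fixes h :: "'a set set \<times> 'a set set \<Rightarrow> real"
  assumes ne: "V \<noteq> {}"
    and fin: "\<And>u f. u \<in> V \<Longrightarrow> finite (set_pmf (rec (V - cluster u f)))"
    and step: "\<And>u f. u \<in> V \<Longrightarrow>
      measure_pmf.expectation (rec (V - cluster u f)) (\<lambda>(P, Q). h (insert (cluster u f) P, queried u f \<union> Q))
        \<le> X u f + c * real (card {e \<in> edges (V - cluster u f). orc e})"
    and round: "(\<Sum>u\<in>V. measure_pmf.expectation (coins u) (X u))
      \<le> c * (\<Sum>u\<in>V. measure_pmf.expectation (coins u) (\<lambda>f. real (card (removed_mistakes u f))))"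
  shows "measure_pmf.expectation (round_then rec) h \<le> c * real (card {e \<in> edges V. orc e})"
proof -
  let ?D = "real (card {e \<in> edges V. orc e})"
  let ?r = "\<lambda>u. measure_pmf.expectation (coins u) (\<lambda>f. real (card (removed_mistakes u f)))"
  let ?B = "\<lambda>u. bind_pmf (coins u) (\<lambda>f.
     map_pmf (\<lambda>(P, Q). (insert (cluster u f) P, queried u f \<union> Q)) (rec (V - cluster u f)))"
  have B: "measure_pmf.expectation (?B u) h
      \<le> measure_pmf.expectation (coins u) (X u) + (c * ?D - c * ?r u)" if u: "u \<in> V" for u
  proof -
    have "measure_pmf.expectation (?B u) h = measure_pmf.expectation (coins u) (\<lambda>f.
        measure_pmf.expectation (rec (V - cluster u f)) (\<lambda>(P, Q). h (insert (cluster u f) P, queried u f \<union> Q)))"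
      using u fin by (subst expectation_bind_finite) (auto simp: finite_set_coins split_def)
    also have "\<dots> \<le> measure_pmf.expectation (coins u)
        (\<lambda>f. X u f + (c * ?D - c * real (card (removed_mistakes u f))))"
    proof (rule expectation_mono_finite[OF finite_set_coins])
      fix f
      show "measure_pmf.expectation (rec (V - cluster u f)) (\<lambda>(P, Q). h (insert (cluster u f) P, queried u f \<union> Q))
          \<le> X u f + (c * ?D - c * real (card (removed_mistakes u f)))"
        using step[OF u, of f] by (simp add: card_removed_mistakes[of u f] algebra_simps)
    qed
    also have "\<dots> = measure_pmf.expectation (coins u) (X u) + (c * ?D - c * ?r u)"
      by (simp add: integrable_measure_pmf_finite finite_set_coins)
    finally show ?thesis .
  qed
  have "measure_pmf.expectation (round_then rec) h = measure_pmf.expectation (pmf_of_set V) (\<lambda>u. measure_pmf.expectation (?B u) h)"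
    unfolding round_then_def using ne finite_V fin
    by (intro expectation_bind_finite) (auto simp: finite_set_coins)
  also have "\<dots> = (\<Sum>u\<in>V. measure_pmf.expectation (?B u) h) / card V"
    using ne finite_V by (simp add: integral_pmf_of_set)
  also have "\<dots> \<le> (\<Sum>u\<in>V. measure_pmf.expectation (coins u) (X u) + (c * ?D - c * ?r u)) / card V"
    using B by (intro divide_right_mono sum_mono) auto
  also have "\<dots> \<le> (card V * (c * ?D)) / card V"
    using round by (intro divide_right_mono) (auto simp: sum.distrib sum_subtractf sum_distrib_left)
  also have "\<dots> = c * ?D" using ne finite_V by simp
  finally show ?thesis .
qed

end

text \<open>The induction also carries finite support, which linearity of expectation uses, and the
  partition property, on which the splitting of the cost rests.\<close>

lemma random_query_pivot_bounds:
  fixes cl :: "'a \<Rightarrow> 'b"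
  assumes p: "0 \<le> p" "p \<le> 1" and "finite V"
    and "\<And>x y. x \<in> V \<Longrightarrow> y \<in> V \<Longrightarrow> x \<noteq> y \<Longrightarrow>
      orc {x, y} \<longleftrightarrow> (lab {x, y} = Plus \<longleftrightarrow> cl x \<noteq> cl y)"
    and a: "2 \<le> a" "3 / (1 + 2 * p) \<le> a" and b: "1 \<le> b" "4 * p \<le> b"
  defines "R \<equiv> random_query_pivot p lab orc"
  shows "finite (set_pmf (R V)) \<and> (\<forall>(P, Q)\<in>set_pmf (R V). partition_on V P)
    \<and> measure_pmf.expectation (R V) (\<lambda>(P, Q). real (cost V lab P)) \<le> a * real (card {e \<in> edges V. orc e})
    \<and> measure_pmf.expectation (R V) (\<lambda>(P, Q). real (card Q)) \<le> b * real (card {e \<in> edges V. orc e})"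
  using assms(3,4)
proof (induction V rule: finite_psubset_induct)
  case (psubset V)
  show ?case
  proof (cases "V = {}")
    case True
    have "R {} = return_pmf ({}, {})" by (simp add: R_def random_query_pivot.simps)
    moreover have "cost {} lab {} = 0" by (simp add: cost_def mistakes_def edges_def)
    ultimately show ?thesis using True a b by (simp add: partition_on_def)
  next
    case ne: False
    interpret pivot_round p V lab orc cl
      using p psubset by unfold_locales auto
    have R: "R V = round_then R" unfolding R_def by (rule random_query_pivot_round[OF ne])
    have IH: "finite (set_pmf (R (V - cluster u f)))"
      "\<And>P Q. (P, Q) \<in> set_pmf (R (V - cluster u f)) \<Longrightarrow> partition_on (V - cluster u f) P"
      "measure_pmf.expectation (R (V - cluster u f)) (\<lambda>(P, Q). real (cost (V - cluster u f) lab P))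
         \<le> a * real (card {e \<in> edges (V - cluster u f). orc e})"
      "measure_pmf.expectation (R (V - cluster u f)) (\<lambda>(P, Q). real (card Q))
         \<le> b * real (card {e \<in> edges (V - cluster u f). orc e})" if "u \<in> V" for u f
    proof -
      have "V - cluster u f \<subset> V" using that pivot_in_cluster[of u f] by auto
      then have *: "finite (set_pmf (R (V - cluster u f))) \<and> (\<forall>(P, Q)\<in>set_pmf (R (V - cluster u f)). partition_on (V - cluster u f) P)
        \<and> measure_pmf.expectation (R (V - cluster u f)) (\<lambda>(P, Q). real (cost (V - cluster u f) lab P))
           \<le> a * real (card {e \<in> edges (V - cluster u f). orc e})
        \<and> measure_pmf.expectation (R (V - cluster u f)) (\<lambda>(P, Q). real (card Q))
           \<le> b * real (card {e \<in> edges (V - cluster u f). orc e})"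
        by (rule psubset.IH) (simp add: orc_iff)
      show "finite (set_pmf (R (V - cluster u f)))"
        "\<And>P Q. (P, Q) \<in> set_pmf (R (V - cluster u f)) \<Longrightarrow> partition_on (V - cluster u f) P"
        "measure_pmf.expectation (R (V - cluster u f)) (\<lambda>(P, Q). real (cost (V - cluster u f) lab P))
         \<le> a * real (card {e \<in> edges (V - cluster u f). orc e})"
        "measure_pmf.expectation (R (V - cluster u f)) (\<lambda>(P, Q). real (card Q))
         \<le> b * real (card {e \<in> edges (V - cluster u f). orc e})"
        using * by blast+
    qed
    have "finite (set_pmf (R V))"
      unfolding R using IH(1) by (rule finite_set_round_then[OF ne])
    moreover have "partition_on V P" if PQ: "(P, Q) \<in> set_pmf (R V)" for P Q
    proof -
      obtain u f P' Q' where *: "u \<in> V" "(P', Q') \<in> set_pmf (R (V - cluster u f))"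
        "(P, Q) = (insert (cluster u f) P', queried u f \<union> Q')"
        using set_pmf_round_then[OF ne PQ[unfolded R]] by metis
      have part: "partition_on (V - cluster u f) P'" by (rule IH(2)[OF *(1,2)])
      then have "disjnt (cluster u f) (\<Union>P')"
        using partition_onD1[OF part] by (auto simp: disjnt_def)
      then have "partition_on V (insert (cluster u f) P')"
        using part cluster_subset[OF *(1)] pivot_in_cluster[of u f] by (auto simp: partition_on_insert)
      then show ?thesis using *(3) by simp
    qed
    moreover have "measure_pmf.expectation (R V) (\<lambda>(P, Q). real (cost V lab P))
        \<le> a * real (card {e \<in> edges V. orc e})"
      unfolding R
    proof (rule expectation_round_then_le[where rec = R and X = "\<lambda>u f. real (card (new_mistakes u f))", OF ne IH(1)])
      fix u f assume u: "u \<in> V"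
      \<comment> \<open>The cost splits for partitions of the remaining vertices, that is, on the
        support, so the integrands agree almost everywhere.\<close>
      have "measure_pmf.expectation (R (V - cluster u f))
          (\<lambda>(P, Q). case (insert (cluster u f) P, queried u f \<union> Q) of (P, Q) \<Rightarrow> real (cost V lab P))
        = measure_pmf.expectation (R (V - cluster u f))
          (\<lambda>x. real (card (new_mistakes u f)) + (case x of (P, Q) \<Rightarrow> real (cost (V - cluster u f) lab P)))"
        using IH(2)[OF u]
        by (intro integral_cong_AE) (auto simp: AE_measure_pmf_iff cost_insert_cluster)
      also have "\<dots> = real (card (new_mistakes u f)) + measure_pmf.expectation (R (V - cluster u f))
          (\<lambda>(P, Q). real (cost (V - cluster u f) lab P))"
        by (simp add: integrable_measure_pmf_finite[OF IH(1)[OF u]])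
      also have "\<dots> \<le> real (card (new_mistakes u f)) + a * real (card {e \<in> edges (V - cluster u f). orc e})"
        using IH(3)[OF u] by simp
      finally show "measure_pmf.expectation (R (V - cluster u f))
          (\<lambda>(P, Q). case (insert (cluster u f) P, queried u f \<union> Q) of (P, Q) \<Rightarrow> real (cost V lab P))
        \<le> real (card (new_mistakes u f)) + a * real (card {e \<in> edges (V - cluster u f). orc e})" .
    qed (use round_mistakes[OF a] in auto)
    moreover have "measure_pmf.expectation (R V) (\<lambda>(P, Q). real (card Q))
        \<le> b * real (card {e \<in> edges V. orc e})"
      unfolding R
    proof (rule expectation_round_then_le[where rec = R and X = "\<lambda>u f. real (card (queried u f))", OF ne IH(1)])
      fix u f assume u: "u \<in> V"
      have "real (card (queried u f \<union> Q)) \<le> real (card (queried u f)) + real (card Q)" for Q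
        using card_Un_le[of "queried u f" Q] by linarith
      then have "measure_pmf.expectation (R (V - cluster u f))
          (\<lambda>(P, Q). case (insert (cluster u f) P, queried u f \<union> Q) of (P, Q) \<Rightarrow> real (card Q))
        \<le> measure_pmf.expectation (R (V - cluster u f))
          (\<lambda>x. real (card (queried u f)) + (case x of (P, Q) \<Rightarrow> real (card Q)))"
        by (intro expectation_mono_finite[OF IH(1)[OF u]]) (auto simp: split_def)
      also have "\<dots> = real (card (queried u f)) + measure_pmf.expectation (R (V - cluster u f))
          (\<lambda>(P, Q). real (card Q))"
        by (simp add: integrable_measure_pmf_finite[OF IH(1)[OF u]])
      also have "\<dots> \<le> real (card (queried u f)) + b * real (card {e \<in> edges (V - cluster u f). orc e})"
        using IH(4)[OF u] by simp
      finally show "measure_pmf.expectation (R (V - cluster u f))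
          (\<lambda>(P, Q). case (insert (cluster u f) P, queried u f \<union> Q) of (P, Q) \<Rightarrow> real (card Q))
        \<le> real (card (queried u f)) + b * real (card {e \<in> edges (V - cluster u f). orc e})" .
    qed (use round_queries[OF b] in auto)
    ultimately show ?thesis by blast
  qed
qed

text \<open>The set of blocks containing a vertex is a singleton by disjointness and serves as its
  block name \<open>cl\<close>, with no choice of a block.\<close>

lemma together_iff_same_blocks:
  assumes "partition_on V P" "x \<in> V" "y \<in> V"
  shows "together P {x, y} \<longleftrightarrow> {C \<in> P. x \<in> C} = {C \<in> P. y \<in> C}"
proof
  assume "together P {x, y}"
  then obtain C where "C \<in> P" "x \<in> C" "y \<in> C" by (auto simp: together_def)
  then have "{C' \<in> P. x \<in> C'} = {C}" "{C' \<in> P. y \<in> C'} = {C}"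
    using partition_onD2[OF assms(1)] unfolding disjoint_def by blast+
  then show "{C \<in> P. x \<in> C} = {C \<in> P. y \<in> C}" by simp
next
  assume eq: "{C \<in> P. x \<in> C} = {C \<in> P. y \<in> C}"
  obtain C where "C \<in> P" "x \<in> C" using assms partition_onD1 by blast
  with eq show "together P {x, y}" by (auto simp: together_def)
qed

theorem theorem2:
  fixes p :: real and V :: "'a set" and lab :: "'a set \<Rightarrow> sign" and OPT :: "'a set set"
  assumes "0 \<le> p" "p \<le> 1"
    and "finite V"
    and "optimal_clustering V lab OPT"
  defines "R \<equiv> random_query_pivot p lab (\<lambda>e. e \<in> mistakes V lab OPT) V"
  shows "(\<forall>(P, Q) \<in> set_pmf R. partition_on V P)
     \<and> measure_pmf.expectation R (\<lambda>(P, Q). real (cost V lab P))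
          \<le> max 2 (3 / (1 + 2 * p)) * real (cost V lab OPT)
     \<and> measure_pmf.expectation R (\<lambda>(P, Q). real (card Q))
          \<le> max (4 * p) 1 * real (cost V lab OPT)"
proof -
  let ?orc = "\<lambda>e. e \<in> mistakes V lab OPT"
  have OPT: "partition_on V OPT" using assms(4) by (simp add: optimal_clustering_def)
  have "?orc {x, y} \<longleftrightarrow> (lab {x, y} = Plus \<longleftrightarrow> {C \<in> OPT. x \<in> C} \<noteq> {C \<in> OPT. y \<in> C})"
    if "x \<in> V" "y \<in> V" "x \<noteq> y" for x y
    unfolding together_iff_same_blocks[OF OPT that(1,2), symmetric]
    using that by (cases "lab {x, y}") (simp_all add: mistakes_def doubleton_in_edges)
  moreover have "{e \<in> edges V. ?orc e} = mistakes V lab OPT" by (auto simp: mistakes_def)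
  ultimately show ?thesis
    using random_query_pivot_bounds[OF assms(1-3), of ?orc lab "\<lambda>x. {C \<in> OPT. x \<in> C}"
        "max 2 (3 / (1 + 2 * p))" "max (4 * p) 1"]
    by (simp add: R_def cost_def)
qed
end
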